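(* Let $\mathcal{A}_n(a,c)$ be a spherical antiprism with $2n$ vertices given by the edge lengths $a,c$. Then the dihedral angles $A$ and $C$ along the edges of $\mathcal{A}_n(a,c)$ of lengths $a$ and $c$, respectively, can be found by the formulae \begin{align*} \cos A&=\frac{\sqrt{1-\cos a}\,\left(2\cos c\,\cos\frac{\pi}{n} - \cos a -1\right)}{\sqrt{2(1+\cos a - 2 \cos^2 c)\left(\cos a - \cos \frac{2\pi}{n}\right)}},\\ \cos C&=\frac{\cos c -\cos a\,\cos c +2(\cos^2 c-1)\cos \frac{\pi}{n}}{1+\cos a - 2 \cos^2 c}. \end{align*}
   Context: $\mathbb{S}^3$ is the three-dimensional spherical space (of constant curvature $1$). A spherical antiprism $\mathcal{A}_n$ is a convex polyhedron in $\mathbb{S}^3$ with $2n$ vertices, having two equal regular $n$-gons as the top and the bottom and $2n$ equal triangles as the lateral faces. It has the symmetry group $S_{2n}$ generated by a mirror-rotational symmetry of order $2n$: the composition of the rotation by the angle $\pi/n$ about the axis passing through the centres of the top and bottom faces and the reflection in a plane perpendicular to this axis and passing through the middles of the lateral edges. When $n=2$, the $n$-gons at the top and the bottom degenerate to two skew edges, and the antiprism is a tetrahedron with symmetry group $S_4$. $\mathcal{A}_n(a,c)$ denotes the antiprism in which $a$ is the length of the edges that form the top and bottom $n$-gonal faces and $c$ is the length of the lateral edges. $A$ denotes the dihedral angle along an edge of length $a$, and $C$ denotes the dihedral angle along a lateral edge (of length $c$).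
   Formalization: For n = 2 the formula for A fails for the tetrahedron's own dihedral angle (a = c = π/2 gives -1/√2, not 0); there A is taken as the angle between a lateral face and the plane through the edge perpendicular to the axis, i.e. π/2 plus half the tetrahedron's dihedral angle. *)

theory Defs
  imports "HOL-Analysis.Analysis"
begin

text \<open>
  The spherical space \<open>S\<^sup>3\<close> is the unit sphere of \<open>real ^ 4\<close>. A convex polyhedron in it is
  identified with the cone over it, so that the polyhedron itself is
  \<open>sphere 0 1 \<inter> convex_cone hull V\<close>, its vertices span the extreme rays of the cone, its faces are
  the facets of the cone, and its face planes (great spheres) are three-dimensional
  linear subspaces.
\<close>

definition sphere_dist :: "real ^ 4 \<Rightarrow> real ^ 4 \<Rightarrow> real" where
  "sphere_dist x y = arccos (x \<bullet> y)"

text \<open>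
  \<open>V\<close> is the vertex set of a nondegenerate convex polyhedron: the cone has nonempty interior,
  contains no pair of antipodal points, and each point of \<open>V\<close> spans an extreme ray.
\<close>

definition convex_polyhedron_vertices :: "(real ^ 4) set \<Rightarrow> bool" where
  "convex_polyhedron_vertices V \<longleftrightarrow>
     finite V \<and> V \<subseteq> sphere 0 1 \<and>
     interior (convex_cone hull V) \<noteq> {} \<and>
     (\<forall>x. x \<in> convex_cone hull V \<and> - x \<in> convex_cone hull V \<longrightarrow> x = 0) \<and>
     (\<forall>x\<in>V. (convex_cone hull {x}) face_of (convex_cone hull V))"

text \<open>
  \<open>u\<close> is the outward unit normal of the cone \<open>K\<close> at the supporting plane \<open>H\<close>. The dihedral
  angle of \<open>K\<close> between two of its face planes, measured inside \<open>K\<close>, is \<open>\<pi>\<close> minus the angle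
  between the outward unit normals.
\<close>

definition outward_normal :: "(real ^ 4) set \<Rightarrow> (real ^ 4) set \<Rightarrow> real ^ 4 \<Rightarrow> bool" where
  "outward_normal K H u \<longleftrightarrow>
     norm u = 1 \<and> H = {x. u \<bullet> x = 0} \<and> (\<forall>x\<in>K. u \<bullet> x \<le> 0)"

definition dihedral_angle :: "(real ^ 4) set \<Rightarrow> (real ^ 4) set \<Rightarrow> (real ^ 4) set \<Rightarrow> real" where
  "dihedral_angle K H H' =
     (THE t. \<exists>u u'. outward_normal K H u \<and> outward_normal K H' u' \<and> t = pi - arccos (u \<bullet> u'))"

text \<open>
  For orthonormal \<open>e1\<close>, \<open>e2\<close>: rotation by the angle \<open>t\<close> about the great circle orthogonal to
  \<open>e1\<close> and \<open>e2\<close>. For a unit vector \<open>e3\<close>: reflection in the great sphere orthogonal to \<open>e3\<close>;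
  this great sphere is perpendicular to that axis iff \<open>e3\<close> is orthogonal to \<open>e1\<close> and \<open>e2\<close>.
\<close>

definition rotation_by :: "real ^ 4 \<Rightarrow> real ^ 4 \<Rightarrow> real \<Rightarrow> real ^ 4 \<Rightarrow> real ^ 4" where
  "rotation_by e1 e2 t x =
     x - (e1 \<bullet> x) *\<^sub>R e1 - (e2 \<bullet> x) *\<^sub>R e2
       + (cos t * (e1 \<bullet> x) - sin t * (e2 \<bullet> x)) *\<^sub>R e1
       + (sin t * (e1 \<bullet> x) + cos t * (e2 \<bullet> x)) *\<^sub>R e2"

definition reflection_in :: "real ^ 4 \<Rightarrow> real ^ 4 \<Rightarrow> real ^ 4" where
  "reflection_in e3 x = x - (2 * (e3 \<bullet> x)) *\<^sub>R e3"

definition mirror_rotation ::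
    "nat \<Rightarrow> real ^ 4 \<Rightarrow> real ^ 4 \<Rightarrow> real ^ 4 \<Rightarrow> real ^ 4 \<Rightarrow> real ^ 4" where
  "mirror_rotation n e1 e2 e3 = reflection_in e3 \<circ> rotation_by e1 e2 (pi / real n)"

text \<open>
  The vertices of an antiprism are \<open>v 0, \<dots>, v (2 * n - 1)\<close>, continued periodically to all
  naturals; those with even index form one base and those with odd index the other. The
  following functions give the vertex sets of the base containing \<open>v k\<close> and of the lateral
  triangle on \<open>v k\<close>, \<open>v (k + 1)\<close>, \<open>v (k + 2)\<close>.
\<close>

definition antiprism_cone :: "(nat \<Rightarrow> real ^ 4) \<Rightarrow> (real ^ 4) set" where
  "antiprism_cone v = convex_cone hull (range v)"

definition base_vertices :: "(nat \<Rightarrow> real ^ 4) \<Rightarrow> nat \<Rightarrow> (real ^ 4) set" where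
  "base_vertices v k = {v (k + 2 * j) | j. True}"

definition lateral_vertices :: "(nat \<Rightarrow> real ^ 4) \<Rightarrow> nat \<Rightarrow> (real ^ 4) set" where
  "lateral_vertices v k = {v k, v (k + 1), v (k + 2)}"

text \<open>
  The mirror-rotation permutes the vertices cyclically, so the bases are congruent regular
  \<open>n\<close>-gons and the lateral triangles are congruent. For \<open>n = 2\<close> the bases degenerate to edges
  and are no longer faces.
\<close>

definition spherical_antiprism ::
    "nat \<Rightarrow> real \<Rightarrow> real \<Rightarrow> real ^ 4 \<Rightarrow> real ^ 4 \<Rightarrow> real ^ 4 \<Rightarrow> (nat \<Rightarrow> real ^ 4) \<Rightarrow> bool" where
  "spherical_antiprism n a c e1 e2 e3 v \<longleftrightarrow>
     n \<ge> 2 \<and>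
     norm e1 = 1 \<and> norm e2 = 1 \<and> norm e3 = 1 \<and> e1 \<bullet> e2 = 0 \<and> e1 \<bullet> e3 = 0 \<and> e2 \<bullet> e3 = 0 \<and>
     (\<forall>k. v (Suc k) = mirror_rotation n e1 e2 e3 (v k)) \<and>
     card (range v) = 2 * n \<and>
     convex_polyhedron_vertices (range v) \<and>
     {F. F facet_of antiprism_cone v} =
       {convex_cone hull (lateral_vertices v k) | k. True} \<union>
       (if n = 2 then {} else {convex_cone hull (base_vertices v k) | k. True}) \<and>
     (\<forall>k. sphere_dist (v k) (v (k + 2)) = a) \<and>
     (\<forall>k. sphere_dist (v k) (v (k + 1)) = c)"

text \<open>
  The plane of a base is the span of its vertices. The degenerate base for \<open>n = 2\<close> is a 2-gon
  in the plane through its edge that is perpendicular to the axis, that is, in the span of its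
  vertices and \<open>e1\<close>, \<open>e2\<close>. (For \<open>n \<ge> 3\<close>, adjoining \<open>e1\<close>, \<open>e2\<close> would not change the span.) So
  for \<open>n = 2\<close> the angle \<open>A\<close> is \<open>\<pi> / 2\<close> plus half of the dihedral angle of the tetrahedron.
\<close>

definition base_plane ::
    "nat \<Rightarrow> real ^ 4 \<Rightarrow> real ^ 4 \<Rightarrow> (nat \<Rightarrow> real ^ 4) \<Rightarrow> nat \<Rightarrow> (real ^ 4) set" where
  "base_plane n e1 e2 v k =
     (if n = 2 then span (base_vertices v k \<union> {e1, e2}) else span (base_vertices v k))"

definition lateral_plane :: "(nat \<Rightarrow> real ^ 4) \<Rightarrow> nat \<Rightarrow> (real ^ 4) set" where
  "lateral_plane v k = span (lateral_vertices v k)"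

text \<open>The dihedral angle along the edge \<open>v k\<close>, \<open>v (k + 2)\<close> of a base.\<close>

definition base_edge_angle ::
    "nat \<Rightarrow> real ^ 4 \<Rightarrow> real ^ 4 \<Rightarrow> (nat \<Rightarrow> real ^ 4) \<Rightarrow> nat \<Rightarrow> real" where
  "base_edge_angle n e1 e2 v k =
     dihedral_angle (antiprism_cone v) (base_plane n e1 e2 v k) (lateral_plane v k)"

text \<open>The dihedral angle along the lateral edge \<open>v (k + 1)\<close>, \<open>v (k + 2)\<close>.\<close>

definition lateral_edge_angle :: "(nat \<Rightarrow> real ^ 4) \<Rightarrow> nat \<Rightarrow> real" where
  "lateral_edge_angle v k =
     dihedral_angle (antiprism_cone v) (lateral_plane v k) (lateral_plane v (k + 1))"

end

theory Submission
  imports Defs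
begin

text \<open>
  A dihedral angle is \<open>\<pi>\<close> minus the angle between two outward normals, so the cosine of the angle
  is minus the normalized inner product of any two outward normals. It thus suffices to find
  the normals explicitly.

  Complete \<open>e1\<close>, \<open>e2\<close>, \<open>e3\<close> to an orthonormal basis of \<open>\<real>\<^sup>4\<close> by a vector \<open>e4\<close>. The
  mirror-rotation turns the \<open>e1\<close>, \<open>e2\<close> coordinates by \<open>\<theta> = \<pi> / n\<close>, changes the sign of the \<open>e3\<close>
  coordinate and fixes the \<open>e4\<close> coordinate. Hence the vertices are
  \<open>v k = (r cos (\<phi> + k \<theta>), r sin (\<phi> + k \<theta>), (-1)\<^sup>k h, m)\<close>
  with \<open>r\<^sup>2 + h\<^sup>2 + m\<^sup>2 = 1\<close>, and \<open>r\<close>, \<open>h\<close>, \<open>m\<close> are all nonzero since otherwise all vertices would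
  lie in one great sphere and the polyhedron would be flat.

  Solving linear equations shows that the plane of the lateral triangle on \<open>v k\<close>, \<open>v (k + 1)\<close>,
  \<open>v (k + 2)\<close> has the normal
  \<open>N k = (2 cos (\<phi> + (k + 1) \<theta>), 2 sin (\<phi> + (k + 1) \<theta>), (-1)\<^sup>k r (1 - cos \<theta>) / h, - r (1 + cos \<theta>) / m)\<close>
  and that the plane of the base on \<open>v k\<close>, \<open>v (k + 2)\<close>, \<dots> has the normal
  \<open>B k = (0, 0, (-1)\<^sup>k / h, - 1 / m)\<close>. Both normals point outwards, because
  \<open>cos ((j - k - 1) \<theta>)\<close> is at most \<open>1\<close>, and at most \<open>cos \<theta>\<close> when \<open>j - k - 1\<close> is odd.

  The inner products of the vertices give \<open>cos a = 1 - 2 r\<^sup>2 sin\<^sup>2 \<theta>\<close> and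
  \<open>cos c = r\<^sup>2 cos \<theta> - h\<^sup>2 + m\<^sup>2\<close>. The expression in the denominators of both formulae is then
  \<open>1 + cos a - 2 cos\<^sup>2 c = 2 h\<^sup>2 m\<^sup>2 |N k|\<^sup>2\<close>, and the second factor under the root is
  \<open>cos a - cos (2 \<theta>) = 2 sin\<^sup>2 \<theta> (h\<^sup>2 + m\<^sup>2)\<close>, where \<open>h\<^sup>2 + m\<^sup>2 = h\<^sup>2 m\<^sup>2 |B k|\<^sup>2\<close>. The formulae are
  what remains of the two quotients after these substitutions.
\<close>

section \<open>Orthogonal complements and cones\<close>

text \<open>
  A hyperplane is recognized from the orthogonal side: linear equations for a vector orthogonal
  to \<open>W\<close> are easier to solve than membership in the span of \<open>W\<close> is to exhibit.
\<close>

lemma span_eq_hyperplane: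
  fixes u :: "'a :: euclidean_space"
  assumes u: "\<And>w. w \<in> W \<Longrightarrow> u \<bullet> w = 0"
    and unique: "\<And>y. (\<And>w. w \<in> W \<Longrightarrow> y \<bullet> w = 0) \<Longrightarrow> \<exists>t. y = t *\<^sub>R u"
  shows "span W = {x. u \<bullet> x = 0}"
proof
  show "span W \<subseteq> {x. u \<bullet> x = 0}"
    using u by (intro span_minimal) (auto simp: subspace_hyperplane)
  show "{x. u \<bullet> x = 0} \<subseteq> span W"
  proof
    fix x assume "x \<in> {x. u \<bullet> x = 0}"
    then have x: "u \<bullet> x = 0" by simp
    obtain y z where yz: "y \<in> span W" "\<And>w. w \<in> span W \<Longrightarrow> orthogonal z w" "x = y + z"
      using orthogonal_subspace_decomp_exists by blast
    have "z \<bullet> w = 0" if "w \<in> W" for w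
      using yz(2) that by (simp add: orthogonal_def span_base)
    then obtain t where t: "z = t *\<^sub>R u"
      using unique by blast
    have "u \<bullet> y = 0"
      using \<open>span W \<subseteq> {x. u \<bullet> x = 0}\<close> yz(1) by auto
    then have "u \<bullet> z = 0"
      using x yz(3) by (simp add: inner_add_right)
    then have "z = 0"
      using t by auto
    then show "x \<in> span W"
      using yz by simp
  qed
qed

lemma convex_cone_hull_le_halfspace:
  fixes u :: "'a :: euclidean_space"
  assumes "\<And>x. x \<in> V \<Longrightarrow> u \<bullet> x \<le> 0" and "x \<in> convex_cone hull V"
  shows "u \<bullet> x \<le> 0"
proof -
  have "convex_cone hull V \<subseteq> {x. u \<bullet> x \<le> 0}"
    using assms(1) by (intro hull_minimal convex_cone_halfspace_le) auto
  then show ?thesis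
    using assms(2) by auto
qed

lemma not_subset_hyperplane_of_interior:
  fixes u :: "'a :: euclidean_space"
  assumes "interior K \<noteq> {}" and "u \<noteq> 0"
  obtains x where "x \<in> K" and "u \<bullet> x \<noteq> 0"
proof -
  have "\<not> K \<subseteq> {x. u \<bullet> x = 0}"
    using interior_mono[of K "{x. u \<bullet> x = 0}"] assms by auto
  then show ?thesis
    using that by auto
qed

lemma orthogonal_to_generators_eq_0:
  fixes u :: "'a :: euclidean_space"
  assumes "interior (convex_cone hull V) \<noteq> {}" and "\<And>x. x \<in> V \<Longrightarrow> u \<bullet> x = 0"
  shows "u = 0"
proof (rule ccontr)
  assume "u \<noteq> 0"
  then obtain x where x: "x \<in> convex_cone hull V" "u \<bullet> x \<noteq> 0"
    using not_subset_hyperplane_of_interior assms(1) by blast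
  have "w \<bullet> x \<le> 0" if "w \<in> {u, - u}" for w
    using that assms(2) by (intro convex_cone_hull_le_halfspace[OF _ x(1)]) auto
  from this[of u] this[of "- u"] show False
    using x(2) by simp
qed

section \<open>Dihedral angles from unnormalized normals\<close>

text \<open>
  The plane determines the unit normal up to sign, and a cone with interior points lies on only
  one side of it.
\<close>

lemma outward_normal_unique:
  assumes "outward_normal K H u" and "outward_normal K H u'" and "interior K \<noteq> {}"
  shows "u' = u"
proof -
  have unit: "u \<bullet> u = 1" "u' \<bullet> u' = 1"
    using assms by (auto simp: outward_normal_def norm_eq_1)
  define t where "t = u \<bullet> u'"
  have "u' - t *\<^sub>R u \<in> H"
    using assms(1) unit by (auto simp: outward_normal_def inner_diff_right t_def)
  then have "u' \<bullet> (u' - t *\<^sub>R u) = 0"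
    using assms(2) by (auto simp: outward_normal_def)
  then have t2: "t * t = 1"
    using unit by (simp add: inner_diff_right t_def inner_commute)
  (* By the equality case of Cauchy-Schwarz. *)
  have "(u' - t *\<^sub>R u) \<bullet> (u' - t *\<^sub>R u) = 0"
    using unit t2 by (simp add: inner_diff_right inner_diff_left inner_commute flip: t_def)
  then have u': "u' = t *\<^sub>R u"
    by simp
  have "t \<noteq> - 1"
  proof
    assume "t = - 1"
    then have "u' = - u"
      using u' by simp
    have "u \<noteq> 0"
      using unit by auto
    then obtain x where x: "x \<in> K" "u \<bullet> x \<noteq> 0"
      using not_subset_hyperplane_of_interior assms(3) by blast
    have "u \<bullet> x \<le> 0" "u' \<bullet> x \<le> 0"
      using assms(1,2) x(1) by (auto simp: outward_normal_def)
    then show False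
      using x(2) \<open>u' = - u\<close> by simp
  qed
  moreover have "t = 1 \<or> t = - 1"
    using t2 by (simp add: square_eq_1_iff)
  ultimately show ?thesis
    using u' by simp
qed

lemma outward_normal_sgn:
  assumes "u \<noteq> 0" and "H = {x. u \<bullet> x = 0}" and "\<And>x. x \<in> K \<Longrightarrow> u \<bullet> x \<le> 0"
  shows "outward_normal K H (sgn u)"
  using assms
  by (auto simp: outward_normal_def sgn_div_norm mult_nonneg_nonpos divide_nonpos_pos norm_sgn)

text \<open>
  The definite description in the dihedral angle has a unique solution because each normal does.
  Scaling the normals is left to the denominator, so that normals given by rational expressions
  can be inserted directly.
\<close>

lemma cos_dihedral_angle:
  assumes int: "interior K \<noteq> {}"
    and u: "u \<noteq> 0" "H = {x. u \<bullet> x = 0}" "\<And>x. x \<in> K \<Longrightarrow> u \<bullet> x \<le> 0"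
    and u': "u' \<noteq> 0" "H' = {x. u' \<bullet> x = 0}" "\<And>x. x \<in> K \<Longrightarrow> u' \<bullet> x \<le> 0"
  shows "cos (dihedral_angle K H H') = - (u \<bullet> u') / (norm u * norm u')"
proof -
  have N: "outward_normal K H (sgn u)" "outward_normal K H' (sgn u')"
    using outward_normal_sgn u u' by blast+
  have "dihedral_angle K H H' = pi - arccos (sgn u \<bullet> sgn u')"
    unfolding dihedral_angle_def
  proof (rule the_equality)
    show "\<exists>w w'. outward_normal K H w \<and> outward_normal K H' w' \<and>
        pi - arccos (sgn u \<bullet> sgn u') = pi - arccos (w \<bullet> w')"
      using N by blast
  next
    fix t assume "\<exists>w w'. outward_normal K H w \<and> outward_normal K H' w' \<and> t = pi - arccos (w \<bullet> w')"
    then show "t = pi - arccos (sgn u \<bullet> sgn u')"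
      using outward_normal_unique[OF N(1) _ int] outward_normal_unique[OF N(2) _ int] by blast
  qed
  moreover have "\<bar>sgn u \<bullet> sgn u'\<bar> \<le> 1"
    using Cauchy_Schwarz_ineq2[of "sgn u" "sgn u'"] u(1) u'(1) by (simp add: norm_sgn)
  ultimately have "cos (dihedral_angle K H H') = - (sgn u \<bullet> sgn u')"
    by (simp add: cos_arccos_abs)
  then show ?thesis
    by (simp add: sgn_div_norm divide_inverse mult_ac)
qed

section \<open>Orthonormal frames\<close>

locale orthonormal_frame =
  fixes e1 e2 e3 e4 :: "real ^ 4"
  assumes unit [simp]: "e1 \<bullet> e1 = 1" "e2 \<bullet> e2 = 1" "e3 \<bullet> e3 = 1" "e4 \<bullet> e4 = 1"
    and perp [simp]: "e1 \<bullet> e2 = 0" "e1 \<bullet> e3 = 0" "e2 \<bullet> e3 = 0"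
      "e1 \<bullet> e4 = 0" "e2 \<bullet> e4 = 0" "e3 \<bullet> e4 = 0"
begin

lemma perp_sym [simp]: "e2 \<bullet> e1 = 0" "e3 \<bullet> e1 = 0" "e3 \<bullet> e2 = 0"
    "e4 \<bullet> e1 = 0" "e4 \<bullet> e2 = 0" "e4 \<bullet> e3 = 0"
  by (subst inner_commute, simp)+

definition combination :: "real \<Rightarrow> real \<Rightarrow> real \<Rightarrow> real \<Rightarrow> real ^ 4" where
  "combination x1 x2 x3 x4 = x1 *\<^sub>R e1 + x2 *\<^sub>R e2 + x3 *\<^sub>R e3 + x4 *\<^sub>R e4"

lemma coordinates_combination [simp]:
  "e1 \<bullet> combination x1 x2 x3 x4 = x1" "e2 \<bullet> combination x1 x2 x3 x4 = x2"
  "e3 \<bullet> combination x1 x2 x3 x4 = x3" "e4 \<bullet> combination x1 x2 x3 x4 = x4"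
  by (simp_all add: combination_def inner_add_right)

lemma expansion: "x = combination (e1 \<bullet> x) (e2 \<bullet> x) (e3 \<bullet> x) (e4 \<bullet> x)"
proof -
  let ?B = "{e1, e2, e3, e4}"
  have distinct: "e1 \<noteq> e2" "e1 \<noteq> e3" "e1 \<noteq> e4" "e2 \<noteq> e3" "e2 \<noteq> e4" "e3 \<noteq> e4"
    using unit perp by force+
  have orth: "pairwise orthogonal ?B"
    by (auto simp: pairwise_def orthogonal_def)
  have "0 \<notin> ?B"
    using unit inner_zero_left by (metis empty_iff insert_iff zero_neq_one)
  then have "independent ?B"
    using orth pairwise_orthogonal_independent by blast
  moreover have "card ?B = dim (UNIV :: (real ^ 4) set)"
    using distinct by simp
  ultimately have "x \<in> span ?B"
    using card_eq_dim[of ?B UNIV] by auto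
  moreover have "norm b = 1" if "b \<in> ?B" for b
    using that by (auto simp: norm_eq_1)
  ultimately have "(\<Sum>b\<in>?B. (x \<bullet> b) *\<^sub>R b) = x"
    by (intro orthonormal_basis_expand orth) auto
  then show ?thesis
    using distinct by (simp add: combination_def inner_commute add.assoc)
qed

lemma inner_combination [simp]:
  "combination x1 x2 x3 x4 \<bullet> y =
     x1 * (e1 \<bullet> y) + x2 * (e2 \<bullet> y) + x3 * (e3 \<bullet> y) + x4 * (e4 \<bullet> y)"
  by (simp add: combination_def inner_add_left)

lemma inner_eq_coordinates:
  "x \<bullet> y = (e1 \<bullet> x) * (e1 \<bullet> y) + (e2 \<bullet> x) * (e2 \<bullet> y) + (e3 \<bullet> x) * (e3 \<bullet> y) + (e4 \<bullet> x) * (e4 \<bullet> y)"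
proof -
  have "x \<bullet> y = combination (e1 \<bullet> x) (e2 \<bullet> x) (e3 \<bullet> x) (e4 \<bullet> x) \<bullet> y"
    using expansion[of x] by simp
  then show ?thesis
    by simp
qed

lemma eq_by_coordinates:
  assumes "e1 \<bullet> x = e1 \<bullet> y" "e2 \<bullet> x = e2 \<bullet> y" "e3 \<bullet> x = e3 \<bullet> y" "e4 \<bullet> x = e4 \<bullet> y"
  shows "x = y"
  using expansion[of x] expansion[of y] assms by simp

end

lemma orthonormal_frame_exists:
  fixes e1 e2 e3 :: "real ^ 4"
  assumes "norm e1 = 1" "norm e2 = 1" "norm e3 = 1" "e1 \<bullet> e2 = 0" "e1 \<bullet> e3 = 0" "e2 \<bullet> e3 = 0"
  obtains e4 where "orthonormal_frame e1 e2 e3 e4"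
proof -
  have "dim {e1, e2, e3} \<le> card {e1, e2, e3}"
    by (rule dim_le_card') simp
  also have "\<dots> \<le> 3"
    by (simp add: card_insert_if)
  finally have "dim {e1, e2, e3} < DIM(real ^ 4)"
    by simp
  then obtain x where x: "x \<noteq> 0" "\<And>y. y \<in> span {e1, e2, e3} \<Longrightarrow> orthogonal x y"
    using orthogonal_to_subspace_exists by blast
  have "e \<bullet> sgn x = 0" if "e \<in> {e1, e2, e3}" for e
    using x(2)[OF span_base[OF that]] by (simp add: orthogonal_def sgn_div_norm inner_commute)
  moreover have "sgn x \<bullet> sgn x = 1"
    using x(1) by (simp add: norm_sgn flip: norm_eq_1)
  ultimately have "orthonormal_frame e1 e2 e3 (sgn x)"
    using assms by unfold_locales (auto simp: norm_eq_1)
  then show ?thesis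
    using that by blast
qed

section \<open>An angle estimate\<close>

text \<open>
  Modulo \<open>2 * n\<close> the integer \<open>j\<close> is one of \<open>1, \<dots>, 2 * n - 1\<close>, and among the corresponding
  angles the cosine is largest at the two ends.
\<close>

lemma cos_odd_multiple_le:
  fixes n :: nat and j :: int
  assumes "n > 0" and "odd j"
  shows "cos (of_int j * (pi / real n)) \<le> cos (pi / real n)"
proof -
  define i where "i = j mod (2 * int n)"
  have "odd i"
    using assms(2) by (simp add: i_def dvd_mod_iff)
  moreover have "0 \<le> i" "i < 2 * int n"
    using assms(1) by (auto simp: i_def)
  ultimately have i: "1 \<le> i" "i \<le> 2 * int n - 1"
    by (cases "i = 0"; auto)+
  obtain q where "j = i + q * (2 * int n)"
    unfolding i_def by (metis mod_div_mult_eq)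
  then have "of_int j = of_int i + of_int q * (2 * real n)"
    by simp
  then have "of_int j * (pi / real n) = of_int i * (pi / real n) + (2 * pi) * of_int q"
    using assms(1) by (simp add: field_simps)
  then have eq: "cos (of_int j * (pi / real n)) = cos (of_int i * (pi / real n))"
    by (simp only: cos_add sin_int_2pin cos_int_2pin)
  show ?thesis
  proof (cases "i \<le> int n")
    case True
    have "of_int i * (pi / real n) \<le> pi"
      using True assms(1) by (simp add: field_simps)
    moreover have "pi / real n \<le> of_int i * (pi / real n)"
      using i(1) assms(1) by (simp add: field_simps)
    ultimately show ?thesis
      unfolding eq using assms(1) by (intro cos_monotone_0_pi_le) auto
  next
    case False
    let ?i = "2 * int n - i"
    have "cos (of_int i * (pi / real n)) = cos (2 * pi - of_int i * (pi / real n))"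
      by simp
    also have "2 * pi - of_int i * (pi / real n) = of_int ?i * (pi / real n)"
      using assms(1) by (simp add: field_simps)
    also have "cos \<dots> \<le> cos (pi / real n)"
    proof (rule cos_monotone_0_pi_le)
      have "real_of_int ?i \<le> real n"
        using False by linarith
      then show "of_int ?i * (pi / real n) \<le> pi"
        using assms(1) by (simp add: field_simps)
      have "1 \<le> real_of_int ?i"
        using i(2) by linarith
      then show "pi / real n \<le> of_int ?i * (pi / real n)"
        using assms(1) mult_right_mono[of 1 "real_of_int ?i" "pi / real n"] by simp
    qed (use assms(1) in auto)
    finally show ?thesis
      unfolding eq .
  qed
qed

section \<open>The antiprism in coordinates\<close>

locale antiprism_coordinates = orthonormal_frame e1 e2 e3 e4
  for e1 e2 e3 e4 :: "real ^ 4" +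
  fixes n :: nat and v :: "nat \<Rightarrow> real ^ 4" and r h m \<phi> :: real
  assumes n: "n \<ge> 2"
    and r: "r > 0" and h: "h \<noteq> 0" and m: "m \<noteq> 0"
    and sum_squares: "r\<^sup>2 + h\<^sup>2 + m\<^sup>2 = 1"
    and v_coordinates [simp]:
      "e1 \<bullet> v k = r * cos (\<phi> + real k * (pi / real n))"
      "e2 \<bullet> v k = r * sin (\<phi> + real k * (pi / real n))"
      "e3 \<bullet> v k = (- 1) ^ k * h"
      "e4 \<bullet> v k = m"
begin

abbreviation \<theta> :: real where "\<theta> \<equiv> pi / real n"

abbreviation angle :: "nat \<Rightarrow> real" where "angle k \<equiv> \<phi> + real k * \<theta>"

text \<open>
  Both normals have \<open>h\<close> and \<open>m\<close> in denominators instead of being cleared of them, so that they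
  point outwards for either sign of \<open>h\<close> and \<open>m\<close>.
\<close>

definition lateral_normal :: "nat \<Rightarrow> real ^ 4" where
  "lateral_normal k = combination (2 * cos (angle (k + 1))) (2 * sin (angle (k + 1)))
     ((- 1) ^ k * (r * (1 - cos \<theta>) / h)) (- (r * (1 + cos \<theta>) / m))"

definition base_normal :: "nat \<Rightarrow> real ^ 4" where
  "base_normal k = combination 0 0 ((- 1) ^ k / h) (- (1 / m))"

lemma sin_\<theta>_pos: "sin \<theta> > 0"
  using n by (intro sin_gt_zero) (auto simp: field_simps)

lemma cos_diff_angle: "cos (angle i) * cos (angle j) + sin (angle i) * sin (angle j) =
    cos ((real j - real i) * \<theta>)"
proof -
  have "(real j - real i) * \<theta> = angle j - angle i"
    by (simp add: algebra_simps)
  then show ?thesis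
    by (simp only: cos_diff) simp
qed

lemma inner_vertices: "v i \<bullet> v j = r\<^sup>2 * cos ((real j - real i) * \<theta>) + (- 1) ^ (i + j) * h\<^sup>2 + m\<^sup>2"
  unfolding inner_eq_coordinates[of "v i"] cos_diff_angle[symmetric]
  by (simp add: power_add power2_eq_square algebra_simps)

lemma inner_lateral_normal_vertex:
  "lateral_normal k \<bullet> v j =
     r * (2 * cos ((real j - real (k + 1)) * \<theta>) + (- 1) ^ (k + j) * (1 - cos \<theta>) - (1 + cos \<theta>))"
  unfolding inner_eq_coordinates[of "lateral_normal k"] cos_diff_angle[symmetric]
  using h m by (simp add: lateral_normal_def power_add field_simps)

lemma inner_base_normal_vertex: "base_normal k \<bullet> v j = (- 1) ^ (k + j) - 1"
  unfolding inner_eq_coordinates[of "base_normal k"]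
  using h m by (simp add: base_normal_def power_add)

text \<open>
  The vertices of the two bases are separated by the parity of \<open>j - k\<close>: for even \<open>j - k\<close> the
  bracket in the product is \<open>2 (cos ((j - k - 1) \<theta>) - cos \<theta>)\<close> with \<open>j - k - 1\<close> odd, and
  otherwise it is \<open>2 (cos ((j - k - 1) \<theta>) - 1)\<close>.
\<close>

lemma lateral_normal_outward: "lateral_normal k \<bullet> v j \<le> 0"
proof (cases "even (k + j)")
  case True
  let ?i = "int j - int (k + 1)"
  have "cos ((real j - real (k + 1)) * \<theta>) \<le> cos \<theta>"
    using cos_odd_multiple_le[of n ?i] n True by simp
  then show ?thesis
    unfolding inner_lateral_normal_vertex using True r by (simp add: mult_nonneg_nonpos)
next
  case False
  have "cos ((real j - real (k + 1)) * \<theta>) \<le> 1"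
    by simp
  then show ?thesis
    unfolding inner_lateral_normal_vertex using False r by (simp add: mult_nonneg_nonpos)
qed

lemma base_normal_outward: "base_normal k \<bullet> v j \<le> 0"
  unfolding inner_base_normal_vertex by (cases "even (k + j)") auto

text \<open>
  With the \<open>e1\<close>, \<open>e2\<close> coordinates rotated so that the first axis points along \<open>angle k\<close>, a vertex
  \<open>i\<close> steps away from \<open>v k\<close> has the angle \<open>\<plusminus> i \<theta>\<close>; two such vertices on opposite sides give
  equations that differ only in the sign of one term.
\<close>

definition along :: "nat \<Rightarrow> real ^ 4 \<Rightarrow> real" where
  "along k y = (e1 \<bullet> y) * cos (angle k) + (e2 \<bullet> y) * sin (angle k)"

definition across :: "nat \<Rightarrow> real ^ 4 \<Rightarrow> real" where
  "across k y = (e2 \<bullet> y) * cos (angle k) - (e1 \<bullet> y) * sin (angle k)"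

lemma e1_rotated: "e1 \<bullet> y = along k y * cos (angle k) - across k y * sin (angle k)"
proof -
  have "along k y * cos (angle k) - across k y * sin (angle k) =
      (e1 \<bullet> y) * ((sin (angle k))\<^sup>2 + (cos (angle k))\<^sup>2)"
    unfolding along_def across_def by algebra
  then show ?thesis
    by simp
qed

lemma e2_rotated: "e2 \<bullet> y = along k y * sin (angle k) + across k y * cos (angle k)"
proof -
  have "along k y * sin (angle k) + across k y * cos (angle k) =
      (e2 \<bullet> y) * ((sin (angle k))\<^sup>2 + (cos (angle k))\<^sup>2)"
    unfolding along_def across_def by algebra
  then show ?thesis
    by simp
qed

lemma inner_vertex_after:
  "y \<bullet> v (k + i) = r * (along k y * cos (real i * \<theta>) + across k y * sin (real i * \<theta>)) +
     (- 1) ^ (k + i) * h * (e3 \<bullet> y) + m * (e4 \<bullet> y)"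
proof -
  have "angle (k + i) = angle k + real i * \<theta>"
    by (simp add: algebra_simps)
  then have "cos (angle (k + i)) = cos (angle k) * cos (real i * \<theta>) - sin (angle k) * sin (real i * \<theta>)"
    "sin (angle (k + i)) = sin (angle k) * cos (real i * \<theta>) + cos (angle k) * sin (real i * \<theta>)"
    by (simp_all only: cos_add sin_add)
  then show ?thesis
    unfolding inner_eq_coordinates[of y] v_coordinates along_def across_def
    by (simp only:) (simp add: algebra_simps)
qed

lemma inner_vertex_before:
  "y \<bullet> v k = r * (along (k + i) y * cos (real i * \<theta>) - across (k + i) y * sin (real i * \<theta>)) +
     (- 1) ^ k * h * (e3 \<bullet> y) + m * (e4 \<bullet> y)"
proof -
  have "angle k = angle (k + i) - real i * \<theta>"
    by (simp add: algebra_simps)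
  then have "cos (angle k) = cos (angle (k + i)) * cos (real i * \<theta>) + sin (angle (k + i)) * sin (real i * \<theta>)"
    "sin (angle k) = sin (angle (k + i)) * cos (real i * \<theta>) - cos (angle (k + i)) * sin (real i * \<theta>)"
    by (simp_all only: cos_diff sin_diff)
  then show ?thesis
    unfolding inner_eq_coordinates[of y] v_coordinates along_def across_def
    by (simp only:) (simp add: algebra_simps)
qed

text \<open>
  Relative to the middle vertex \<open>v (k + 1)\<close>, the equations for the two outer vertices give
  that a vector orthogonal to the triangle has no component across, and the remaining two equations
  express its \<open>e3\<close> and \<open>e4\<close> coordinates through the component along. This is also where the
  normal comes from: it is the solution whose component along is \<open>2\<close>.
\<close>

lemma lateral_plane_eq: "lateral_plane v k = {x. lateral_normal k \<bullet> x = 0}"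
  unfolding lateral_plane_def
proof (rule span_eq_hyperplane)
  fix w assume "w \<in> lateral_vertices v k"
  then consider "w = v k" | "w = v (k + 1)" | "w = v (k + 2)"
    by (auto simp: lateral_vertices_def)
  then show "lateral_normal k \<bullet> w = 0"
    by cases (simp_all add: inner_lateral_normal_vertex power_add flip: mult_2)
next
  fix y assume y: "\<And>w. w \<in> lateral_vertices v k \<Longrightarrow> y \<bullet> w = 0"
  define X where "X = along (k + 1) y"
  define Y where "Y = across (k + 1) y"
  define z where "z = (- 1) ^ k * (e3 \<bullet> y)"
  have sign: "(- 1) ^ k * ((- 1) ^ k * t) = t" for t :: real
    by (simp flip: power_add mult.assoc mult_2)
  have e3: "e3 \<bullet> y = (- 1) ^ k * z"
    by (simp add: z_def sign)
  have 0: "r * (X * cos \<theta> - Y * sin \<theta>) + h * z + m * (e4 \<bullet> y) = 0"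
    using y[of "v k"] inner_vertex_before[of y k 1]
    by (simp add: lateral_vertices_def X_def Y_def z_def mult_ac)
  have 1: "r * X - h * z + m * (e4 \<bullet> y) = 0"
    using y[of "v (k + 1)"] inner_vertex_after[of y "k + 1" 0]
    by (simp add: lateral_vertices_def X_def Y_def z_def mult_ac)
  have 2: "r * (X * cos \<theta> + Y * sin \<theta>) + h * z + m * (e4 \<bullet> y) = 0"
    using y[of "v (k + 2)"] inner_vertex_after[of y "k + 1" 1]
    by (simp add: lateral_vertices_def X_def Y_def z_def mult_ac)
  have "r * sin \<theta> * Y = 0"
    using 0 2 by algebra
  then have "Y = 0"
    using r sin_\<theta>_pos by simp
  have "h * z = X / 2 * (r * (1 - cos \<theta>))" "m * (e4 \<bullet> y) = - (X / 2 * (r * (1 + cos \<theta>)))"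
    using 0 1 \<open>Y = 0\<close> by (simp_all add: algebra_simps)
  then have z: "z = X / 2 * (r * (1 - cos \<theta>) / h)" and e4: "e4 \<bullet> y = - (X / 2 * (r * (1 + cos \<theta>) / m))"
    using h m by (simp_all add: field_simps)
  have "y = (X / 2) *\<^sub>R lateral_normal k"
    using e1_rotated[of y "k + 1", folded X_def Y_def] e2_rotated[of y "k + 1", folded X_def Y_def]
      \<open>Y = 0\<close> e4
    by (intro eq_by_coordinates) (simp_all add: lateral_normal_def e3 z)
  then show "\<exists>t. y = t *\<^sub>R lateral_normal k" ..
qed

text \<open>
  For \<open>n = 2\<close> the vectors \<open>e1\<close>, \<open>e2\<close> themselves belong to the plane; otherwise three consecutive
  vertices of the base determine it.
\<close>

lemma base_plane_eq: "base_plane n e1 e2 v k = {x. base_normal k \<bullet> x = 0}"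
proof -
  define W where "W = (if n = 2 then base_vertices v k \<union> {e1, e2} else base_vertices v k)"
  have W: "v (k + 2 * j) \<in> W" for j
    by (auto simp: W_def base_vertices_def)
  have "span W = {x. base_normal k \<bullet> x = 0}"
  proof (rule span_eq_hyperplane)
    fix w assume "w \<in> W"
    then consider j where "w = v (k + 2 * j)" | "w = e1" | "w = e2"
      by (auto simp: W_def base_vertices_def split: if_splits)
    then show "base_normal k \<bullet> w = 0"
    proof cases
      case 1
      then show ?thesis
        by (simp add: inner_base_normal_vertex power_add power_mult flip: mult_2)
    qed (simp_all add: inner_commute base_normal_def)
  next
    fix y assume y: "\<And>w. w \<in> W \<Longrightarrow> y \<bullet> w = 0"
    define z where "z = (- 1) ^ k * (e3 \<bullet> y)"
    have e3: "e3 \<bullet> y = (- 1) ^ k * z"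
      by (simp add: z_def flip: power_add mult.assoc mult_2)
    have "e1 \<bullet> y = 0 \<and> e2 \<bullet> y = 0"
    proof (cases "n = 2")
      case True
      then show ?thesis
        using y[of e1] y[of e2] by (simp add: W_def inner_commute)
    next
      case False
      define X where "X = along (k + 2) y"
      define Y where "Y = across (k + 2) y"
      define E where "E = h * z + m * (e4 \<bullet> y)"
      have 0: "r * (X * cos (2 * \<theta>) - Y * sin (2 * \<theta>)) + E = 0"
        using y[OF W[of 0]] inner_vertex_before[of y k 2]
        by (simp add: X_def Y_def z_def E_def mult_ac)
      have 1: "r * X + E = 0"
        using y[OF W[of 1]] inner_vertex_after[of y "k + 2" 0]
        by (simp add: X_def Y_def z_def E_def mult_ac)
      have index: "k + 2 + 2 = k + 2 * 2"
        by simp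
      have 2: "r * (X * cos (2 * \<theta>) + Y * sin (2 * \<theta>)) + E = 0"
        using y[OF W[of 2]] inner_vertex_after[of y "k + 2" 2, unfolded index]
        by (simp add: X_def Y_def z_def E_def power_add mult_ac)
      (* This is where n = 2 differs: there the angle is \<pi>. *)
      have "sin (2 * \<theta>) > 0"
        using n False by (intro sin_gt_zero) (auto simp: field_simps)
      moreover have "r * sin (2 * \<theta>) * Y = 0"
        using 0 2 by algebra
      ultimately have "Y = 0"
        using r by simp
      have "1 - cos (2 * \<theta>) = 2 * (sin \<theta>)\<^sup>2"
        unfolding cos_double_sin by simp
      then have "1 - cos (2 * \<theta>) > 0"
        using sin_\<theta>_pos by simp
      moreover have "r * (1 - cos (2 * \<theta>)) * X = 0"
        using 0 1 \<open>Y = 0\<close> by algebra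
      ultimately have "X = 0"
        using r by simp
      then show ?thesis
        using e1_rotated[of y "k + 2", folded X_def Y_def]
          e2_rotated[of y "k + 2", folded X_def Y_def] \<open>Y = 0\<close>
        by simp
    qed
    moreover from this have "h * z + m * (e4 \<bullet> y) = 0"
      using y[OF W[of 0]] inner_vertex_after[of y k 0]
      by (simp add: along_def z_def mult_ac)
    then have "z = - (m * (e4 \<bullet> y)) / h"
      using h by (simp add: field_simps)
    ultimately have "y = (- m * (e4 \<bullet> y)) *\<^sub>R base_normal k"
      using m by (intro eq_by_coordinates) (simp_all add: base_normal_def e3)
    then show "\<exists>t. y = t *\<^sub>R base_normal k" ..
  qed
  then show ?thesis
    unfolding base_plane_def W_def by (cases "n = 2") simp_all
qed

lemma sign_squared: "((- 1) ^ k)\<^sup>2 = (1 :: real)"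
  by (simp add: power2_eq_square)

lemma lateral_normal_sq: "(norm (lateral_normal k))\<^sup>2 =
    4 + (r * (1 - cos \<theta>) / h)\<^sup>2 + (r * (1 + cos \<theta>) / m)\<^sup>2"
proof -
  define p q w where "p = r * (1 - cos \<theta>) / h" and "q = r * (1 + cos \<theta>) / m" and "w = angle (k + 1)"
  have "(norm (lateral_normal k))\<^sup>2 = 4 * ((cos w)\<^sup>2 + (sin w)\<^sup>2) + ((- 1) ^ k * p)\<^sup>2 + q\<^sup>2"
    unfolding power2_norm_eq_inner lateral_normal_def inner_combination coordinates_combination
      p_def[symmetric] q_def[symmetric] w_def[symmetric]
    by (simp add: power2_eq_square) (simp flip: distrib_left)
  also have "\<dots> = 4 + p\<^sup>2 + q\<^sup>2"
    by (simp add: power_mult_distrib sign_squared)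
  finally show ?thesis
    by (simp add: p_def q_def)
qed

lemma inner_consecutive_lateral_normals: "lateral_normal k \<bullet> lateral_normal (k + 1) =
    4 * cos \<theta> - (r * (1 - cos \<theta>) / h)\<^sup>2 + (r * (1 + cos \<theta>) / m)\<^sup>2"
proof -
  define p q where "p = r * (1 - cos \<theta>) / h" and "q = r * (1 + cos \<theta>) / m"
  have "lateral_normal k \<bullet> lateral_normal (k + 1) =
      4 * (cos (angle (k + 1)) * cos (angle (k + 1 + 1)) + sin (angle (k + 1)) * sin (angle (k + 1 + 1)))
      - ((- 1) ^ k * p)\<^sup>2 + q\<^sup>2"
    unfolding lateral_normal_def inner_combination coordinates_combination
      p_def[symmetric] q_def[symmetric]
    by (simp add: power2_eq_square)
  also have "\<dots> = 4 * cos \<theta> - p\<^sup>2 + q\<^sup>2"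
    unfolding cos_diff_angle by (simp add: power_mult_distrib sign_squared)
  finally show ?thesis
    by (simp add: p_def q_def)
qed

lemma base_normal_sq: "(norm (base_normal k))\<^sup>2 = (1 / h)\<^sup>2 + (1 / m)\<^sup>2"
  unfolding power2_norm_eq_inner inner_eq_coordinates[of "base_normal k"]
  by (simp add: base_normal_def power2_eq_square flip: power_add mult_2)

lemma inner_base_lateral_normal:
  "base_normal k \<bullet> lateral_normal k = r * (1 - cos \<theta>) / h\<^sup>2 + r * (1 + cos \<theta>) / m\<^sup>2"
  unfolding inner_eq_coordinates[of "base_normal k"]
  by (simp add: base_normal_def lateral_normal_def power2_eq_square flip: power_add mult_2)

lemma lateral_normal_nonzero: "lateral_normal k \<noteq> 0"
proof -
  have "(norm (lateral_normal k))\<^sup>2 \<ge> 4"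
    unfolding lateral_normal_sq by simp
  then show ?thesis
    by auto
qed

lemma base_normal_nonzero: "base_normal k \<noteq> 0"
proof
  assume "base_normal k = 0"
  then have "e4 \<bullet> base_normal k = 0"
    by simp
  then show False
    using m by (simp add: base_normal_def)
qed

lemma inner_base_edge: "v k \<bullet> v (k + 2) = 1 - 2 * r\<^sup>2 * (sin \<theta>)\<^sup>2"
proof -
  have "v k \<bullet> v (k + 2) = r\<^sup>2 * cos (2 * \<theta>) + h\<^sup>2 + m\<^sup>2"
    unfolding inner_vertices by simp
  then show ?thesis
    using sum_squares unfolding cos_double_sin by algebra
qed

lemma inner_lateral_edge: "v k \<bullet> v (k + 1) = r\<^sup>2 * cos \<theta> - h\<^sup>2 + m\<^sup>2"
  unfolding inner_vertices by simp

text \<open>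
  The variables \<open>ca\<close> and \<open>cc\<close> stand for \<open>cos a\<close> and \<open>cos c\<close>. The factors
  of the two formulae are rational functions of \<open>r\<close>, \<open>h\<close>, \<open>m\<close>, \<open>sin \<theta>\<close>, \<open>cos \<theta>\<close>; once cleared
  of denominators, the identities for them are polynomial modulo
  \<open>r\<^sup>2 + h\<^sup>2 + m\<^sup>2 = 1\<close> and \<open>sin\<^sup>2 \<theta> + cos\<^sup>2 \<theta> = 1\<close>.
\<close>

context
  fixes ca cc :: real
  assumes ca: "ca = 1 - 2 * r\<^sup>2 * (sin \<theta>)\<^sup>2" and cc: "cc = r\<^sup>2 * cos \<theta> - h\<^sup>2 + m\<^sup>2"
begin

lemma cancel_h: "h * (x / h) = x" and cancel_m: "m * (x / m) = x"
  using h m by simp_all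

lemma denominator_eq: "1 + ca - 2 * cc\<^sup>2 = 2 * h\<^sup>2 * m\<^sup>2 * (norm (lateral_normal k))\<^sup>2"
proof -
  have "2 * h\<^sup>2 * m\<^sup>2 * (norm (lateral_normal k))\<^sup>2 =
      8 * h\<^sup>2 * m\<^sup>2 + 2 * r\<^sup>2 * (1 - cos \<theta>)\<^sup>2 * m\<^sup>2 + 2 * r\<^sup>2 * (1 + cos \<theta>)\<^sup>2 * h\<^sup>2"
    unfolding lateral_normal_sq using cancel_h[of "r * (1 - cos \<theta>)"] cancel_m[of "r * (1 + cos \<theta>)"]
    by algebra
  then show ?thesis
    using ca cc sum_squares sin_cos_squared_add[of \<theta>] by algebra
qed

lemma cos_lateral_angle_numerator_eq:
  "cc - ca * cc + 2 * (cc\<^sup>2 - 1) * cos \<theta> =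
     2 * h\<^sup>2 * m\<^sup>2 * (- (lateral_normal k \<bullet> lateral_normal (k + 1)))"
proof -
  have "2 * h\<^sup>2 * m\<^sup>2 * (- (lateral_normal k \<bullet> lateral_normal (k + 1))) =
      - 8 * h\<^sup>2 * m\<^sup>2 * cos \<theta> + 2 * r\<^sup>2 * (1 - cos \<theta>)\<^sup>2 * m\<^sup>2 - 2 * r\<^sup>2 * (1 + cos \<theta>)\<^sup>2 * h\<^sup>2"
    unfolding inner_consecutive_lateral_normals
    using cancel_h[of "r * (1 - cos \<theta>)"] cancel_m[of "r * (1 + cos \<theta>)"]
    by algebra
  then show ?thesis
    using ca cc sum_squares sin_cos_squared_add[of \<theta>] by algebra
qed

lemma cos_base_angle_factor_eq:
  "r * (2 * cc * cos \<theta> - ca - 1) = - 2 * h\<^sup>2 * m\<^sup>2 * (base_normal k \<bullet> lateral_normal k)"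
proof -
  have "h\<^sup>2 * m\<^sup>2 * (base_normal k \<bullet> lateral_normal k) =
      r * ((1 - cos \<theta>) * m\<^sup>2 + (1 + cos \<theta>) * h\<^sup>2)"
    unfolding inner_base_lateral_normal using h m by (simp add: field_simps)
  then show ?thesis
    using ca cc sum_squares sin_cos_squared_add[of \<theta>] by algebra
qed

lemma base_factor_eq:
  "ca - cos (2 * \<theta>) = 2 * (sin \<theta>)\<^sup>2 * (h\<^sup>2 * m\<^sup>2 * (norm (base_normal k))\<^sup>2)"
proof -
  have "h\<^sup>2 * m\<^sup>2 * (norm (base_normal k))\<^sup>2 = h\<^sup>2 + m\<^sup>2"
    unfolding base_normal_sq using h m by (simp add: field_simps)
  then show ?thesis
    using ca sum_squares unfolding cos_double_sin by algebra
qed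

lemma lateral_edge_quotient:
  "- (lateral_normal k \<bullet> lateral_normal (k + 1)) /
     (norm (lateral_normal k) * norm (lateral_normal (k + 1))) =
   (cc - ca * cc + 2 * (cc\<^sup>2 - 1) * cos \<theta>) / (1 + ca - 2 * cc\<^sup>2)"
proof -
  have "norm (lateral_normal (k + 1)) = norm (lateral_normal k)"
    by (rule power2_eq_imp_eq) (simp_all add: lateral_normal_sq)
  then show ?thesis
    unfolding denominator_eq[of k] cos_lateral_angle_numerator_eq[of k]
    using h m by (simp add: power2_eq_square)
qed

text \<open>
  Numerator and denominator share the factor \<open>\<surd>2 sin \<theta>\<close>, which is positive; the factor \<open>r\<close>
  left over from \<open>\<surd>(1 - cos a)\<close> completes the product of the two normals.
\<close>

lemma base_edge_quotient:
  "- (base_normal k \<bullet> lateral_normal k) / (norm (base_normal k) * norm (lateral_normal k)) =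
   sqrt (1 - ca) * (2 * cc * cos \<theta> - ca - 1) /
     sqrt (2 * (1 + ca - 2 * cc\<^sup>2) * (ca - cos (2 * \<theta>)))"
proof -
  define d where "d = h\<^sup>2 * m\<^sup>2"
  define nB where "nB = norm (base_normal k)"
  define nL where "nL = norm (lateral_normal k)"
  have "d > 0"
    using h m by (simp add: d_def)
  have "1 - ca = 2 * (r * sin \<theta>)\<^sup>2"
    by (simp add: ca power_mult_distrib)
  then have 1: "sqrt (1 - ca) = sqrt 2 * sin \<theta> * r"
    using r sin_\<theta>_pos by (simp add: real_sqrt_mult)
  have "2 * (1 + ca - 2 * cc\<^sup>2) * (ca - cos (2 * \<theta>)) = 2 * (2 * sin \<theta> * d * nB * nL)\<^sup>2"
    unfolding denominator_eq[of k] base_factor_eq[of k]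
    by (simp add: d_def nB_def nL_def power2_eq_square)
  then have 2: "sqrt (2 * (1 + ca - 2 * cc\<^sup>2) * (ca - cos (2 * \<theta>))) =
      sqrt 2 * sin \<theta> * (2 * d * nB * nL)"
    using sin_\<theta>_pos \<open>d > 0\<close> by (simp add: real_sqrt_mult nB_def nL_def)
  have 3: "r * (2 * cc * cos \<theta> - ca - 1) = - 2 * d * (base_normal k \<bullet> lateral_normal k)"
    unfolding cos_base_angle_factor_eq[of k] d_def by simp
  have "sqrt (1 - ca) * (2 * cc * cos \<theta> - ca - 1) /
      sqrt (2 * (1 + ca - 2 * cc\<^sup>2) * (ca - cos (2 * \<theta>))) =
      (r * (2 * cc * cos \<theta> - ca - 1)) / (2 * d * nB * nL)"
    unfolding 1 2 using sin_\<theta>_pos by simp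
  also have "\<dots> = - (base_normal k \<bullet> lateral_normal k) / (nB * nL)"
    unfolding 3 using \<open>d > 0\<close> by simp
  finally show ?thesis
    by (simp add: nB_def nL_def)
qed

end

end

text \<open>
  The orbit of \<open>v 0\<close> under the mirror-rotation is computed coordinatewise, with polar coordinates
  for the \<open>e1\<close>, \<open>e2\<close> part. A vanishing \<open>r\<close>, \<open>h\<close> or \<open>m\<close> would make \<open>e1\<close>, \<open>e3\<close> or \<open>e4\<close>
  orthogonal to all vertices.
\<close>

lemma antiprism_coordinates_exist:
  assumes "spherical_antiprism n a c e1 e2 e3 v"
  obtains e4 r h m \<phi> where "antiprism_coordinates e1 e2 e3 e4 n v r h m \<phi>"
proof -
  have n: "n \<ge> 2" and step: "\<And>k. v (Suc k) = mirror_rotation n e1 e2 e3 (v k)"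
    and poly: "convex_polyhedron_vertices (range v)"
    using assms by (auto simp: spherical_antiprism_def)
  obtain e4 where "orthonormal_frame e1 e2 e3 e4"
    using orthonormal_frame_exists[of e1 e2 e3] assms by (auto simp: spherical_antiprism_def)
  then interpret orthonormal_frame e1 e2 e3 e4 .
  define \<theta> where "\<theta> = pi / real n"
  have next_coordinates:
    "e1 \<bullet> v (Suc k) = cos \<theta> * (e1 \<bullet> v k) - sin \<theta> * (e2 \<bullet> v k)"
    "e2 \<bullet> v (Suc k) = sin \<theta> * (e1 \<bullet> v k) + cos \<theta> * (e2 \<bullet> v k)"
    "e3 \<bullet> v (Suc k) = - (e3 \<bullet> v k)"
    "e4 \<bullet> v (Suc k) = e4 \<bullet> v k" for k
    unfolding step mirror_rotation_def reflection_in_def rotation_by_def \<theta>_def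
    by (simp_all add: inner_add_right inner_diff_right)
  (* The polar radius may come out negative, which a half turn of the angle corrects. *)
  obtain r' \<phi>' where polar: "e1 \<bullet> v 0 = r' * cos \<phi>'" "e2 \<bullet> v 0 = r' * sin \<phi>'"
    using polar_Ex by blast
  define r \<phi> where "r = \<bar>r'\<bar>" and "\<phi> = (if r' \<ge> 0 then \<phi>' else \<phi>' + pi)"
  define h m where "h = e3 \<bullet> v 0" and "m = e4 \<bullet> v 0"
  have v12: "e1 \<bullet> v k = r * cos (\<phi> + real k * \<theta>) \<and> e2 \<bullet> v k = r * sin (\<phi> + real k * \<theta>)" for k
  proof (induction k)
    case 0
    then show ?case
      using polar by (simp add: r_def \<phi>_def)
  next
    case (Suc k)
    have "\<phi> + real (Suc k) * \<theta> = (\<phi> + real k * \<theta>) + \<theta>"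
      by (simp add: algebra_simps)
    then show ?case
      using Suc by (simp only: next_coordinates cos_add[of _ \<theta>] sin_add[of _ \<theta>])
        (simp add: algebra_simps)
  qed
  have v3: "e3 \<bullet> v k = (- 1) ^ k * h" and v4: "e4 \<bullet> v k = m" for k
    by (induction k) (simp_all add: next_coordinates h_def m_def)
  have nonflat: "u = 0" if "\<And>k. u \<bullet> v k = 0" for u
    using orthogonal_to_generators_eq_0[of "range v" u] poly that
    by (auto simp: convex_polyhedron_vertices_def)
  have "r \<noteq> 0"
    using nonflat[of e1] v12 unit(1) by force
  have "h \<noteq> 0"
    using nonflat[of e3] v3 unit(3) by force
  have "m \<noteq> 0"
    using nonflat[of e4] v4 unit(4) by force
  have "v 0 \<bullet> v 0 = 1"
    using poly by (auto simp: convex_polyhedron_vertices_def image_subset_iff norm_eq_1)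
  then have "(r * cos \<phi>)\<^sup>2 + (r * sin \<phi>)\<^sup>2 + h\<^sup>2 + m\<^sup>2 = 1"
    using v12[of 0] v3[of 0] v4[of 0] unfolding inner_eq_coordinates[of "v 0"]
    by (simp add: power2_eq_square)
  then have "r\<^sup>2 + h\<^sup>2 + m\<^sup>2 = 1"
    using sin_cos_squared_add[of \<phi>] by algebra
  then have "antiprism_coordinates e1 e2 e3 e4 n v r h m \<phi>"
    using n \<open>r \<noteq> 0\<close> \<open>h \<noteq> 0\<close> \<open>m \<noteq> 0\<close> v12 v3 v4
    by unfold_locales (auto simp: \<theta>_def r_def)
  then show ?thesis
    using that by blast
qed

section \<open>The dihedral angles of the antiprism\<close>

theorem theorem5:
  fixes n k :: nat and a c A C :: real and e1 e2 e3 :: "real ^ 4" and v :: "nat \<Rightarrow> real ^ 4"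
  assumes "spherical_antiprism n a c e1 e2 e3 v"
    and "A = base_edge_angle n e1 e2 v k"
    and "C = lateral_edge_angle v k"
  shows "cos A = sqrt (1 - cos a) * (2 * cos c * cos (pi / real n) - cos a - 1) /
           sqrt (2 * (1 + cos a - 2 * (cos c)\<^sup>2) * (cos a - cos (2 * pi / real n)))
       \<and> cos C = (cos c - cos a * cos c + 2 * ((cos c)\<^sup>2 - 1) * cos (pi / real n)) /
           (1 + cos a - 2 * (cos c)\<^sup>2)"
proof -
  obtain e4 r h m \<phi> where "antiprism_coordinates e1 e2 e3 e4 n v r h m \<phi>"
    using antiprism_coordinates_exist assms(1) by blast
  then interpret antiprism_coordinates e1 e2 e3 e4 n v r h m \<phi> .
  have poly: "convex_polyhedron_vertices (range v)"
    and a: "a = sphere_dist (v 0) (v (0 + 2))" and c: "c = sphere_dist (v 0) (v (0 + 1))"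
    using assms(1) unfolding spherical_antiprism_def by metis+
  have "norm (v j) = 1" for j
    using poly by (auto simp: convex_polyhedron_vertices_def image_subset_iff)
  then have "\<bar>v i \<bullet> v j\<bar> \<le> 1" for i j
    using Cauchy_Schwarz_ineq2[of "v i" "v j"] by simp
  then have cos_dist: "cos (sphere_dist (v i) (v j)) = v i \<bullet> v j" for i j
    by (simp add: sphere_dist_def cos_arccos_abs)
  have ca: "cos a = 1 - 2 * r\<^sup>2 * (sin (pi / real n))\<^sup>2"
    unfolding a cos_dist by (rule inner_base_edge)
  have cc: "cos c = r\<^sup>2 * cos (pi / real n) - h\<^sup>2 + m\<^sup>2"
    unfolding c cos_dist by (rule inner_lateral_edge)
  have int: "interior (antiprism_cone v) \<noteq> {}"
    using poly by (simp add: convex_polyhedron_vertices_def antiprism_cone_def)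
  have lateral: "lateral_normal j \<bullet> x \<le> 0" and base: "base_normal j \<bullet> x \<le> 0"
    if "x \<in> antiprism_cone v" for x j
    using that lateral_normal_outward base_normal_outward unfolding antiprism_cone_def
    by (auto intro: convex_cone_hull_le_halfspace[of "range v"])
  have "cos A = - (base_normal k \<bullet> lateral_normal k) / (norm (base_normal k) * norm (lateral_normal k))"
    unfolding assms(2) base_edge_angle_def
    by (rule cos_dihedral_angle[OF int base_normal_nonzero base_plane_eq base
          lateral_normal_nonzero lateral_plane_eq lateral])
  moreover have "cos C = - (lateral_normal k \<bullet> lateral_normal (k + 1)) /
      (norm (lateral_normal k) * norm (lateral_normal (k + 1)))"
    unfolding assms(3) lateral_edge_angle_def
    by (rule cos_dihedral_angle[OF int lateral_normal_nonzero lateral_plane_eq lateral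
          lateral_normal_nonzero lateral_plane_eq lateral])
  ultimately show ?thesis
    unfolding base_edge_quotient[OF ca cc] lateral_edge_quotient[OF ca cc] by simp
qed

end
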